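(* Let $R$ be a commutative unital ring and let $A=R[t_1,\ldots,t_d]$ be the polynomial algebra with $d\geq 2$. Let $\mu:A^{\otimes 2}\to A$ denote the multiplication. Then the morphism of $R$-modules $$\mathbb{M}\mathrm{Der}(A^{\otimes 2},A^{\otimes 2})\longrightarrow\mathrm{Hom}_R(A^{\otimes 2},A),\qquad \phi\mapsto\mu\circ\phi,$$ is zero.
   Context: All tensor products are over $R$. Let $\tau$ be the transposition of tensor factors of $A^{\otimes 2}$. A map $\phi\in\mathrm{Hom}_R(A^{\otimes 2},A^{\otimes 2})$ is a derivation with respect to the last variable if $\phi(c\otimes ab)=(a\otimes 1)\phi(c\otimes b)+\phi(c\otimes a)(1\otimes b)$ for all $a,b,c\in A$, using the product of $A^{\otimes 2}$. The $R$-module of multi-derivations $\mathbb{M}\mathrm{Der}(A^{\otimes 2},A^{\otimes 2})\subset\mathrm{Hom}_R(A^{\otimes 2},A^{\otimes 2})$ consists of those $\phi$ such that both $\phi$ and $\tau\circ\phi\circ\tau$ are derivations with respect to the last variable. *)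

theory Defs
  imports Complex_Main "HOL-Library.Poly_Mapping" "HOL-Library.Cardinality"
begin

section \<open>Polynomial algebras and free modules\<close>

text \<open>Polynomials over \<^typ>\<open>'r\<close> in indeterminates indexed by \<^typ>\<open>'n\<close>: finitely supported
  coefficient functions on the monomials \<^typ>\<open>'n \<Rightarrow>\<^sub>0 nat\<close>, with the convolution product of
  \<^theory>\<open>HOL-Library.Poly_Mapping\<close>. For \<open>'n\<close> finite with \<open>d\<close> elements this is
  \<open>R[t\<^sub>1,\<dots>,t\<^sub>d]\<close>.\<close>

type_synonym ('n, 'r) mpoly = "('n \<Rightarrow>\<^sub>0 nat) \<Rightarrow>\<^sub>0 'r"

text \<open>Scalar multiplication on finitely supported functions; it serves both for polynomials and for
  the free module on a set of generators.\<close>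

definition pscale :: "'r::comm_ring_1 \<Rightarrow> ('k \<Rightarrow>\<^sub>0 'r) \<Rightarrow> ('k \<Rightarrow>\<^sub>0 'r)"
  where "pscale r p = Poly_Mapping.map ((*) r) p"

lemma lookup_pscale [simp]: "Poly_Mapping.lookup (pscale r p) k = r * Poly_Mapping.lookup p k"
  by (simp add: pscale_def Poly_Mapping.map.rep_eq when_def)

interpretation pm: module pscale
  by unfold_locales (auto intro!: poly_mapping_eqI simp: lookup_add algebra_simps)

lemma pscale_eq_mult: "pscale r (p :: ('k::comm_monoid_add) \<Rightarrow>\<^sub>0 'r::comm_ring_1) = Poly_Mapping.single 0 r * p"
  by (simp add: pscale_def mult_map_scale_conv_mult)

lemma pscale_mult_left: "pscale r p * q = pscale r (p * q :: ('k::comm_monoid_add) \<Rightarrow>\<^sub>0 'r::comm_ring_1)"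
  and pscale_mult_right: "p * pscale r q = pscale r (p * q)"
  by (simp_all add: pscale_eq_mult algebra_simps)

definition free_lift :: "('r::comm_ring_1 \<Rightarrow> 'm \<Rightarrow> 'm::ab_group_add) \<Rightarrow> ('k \<Rightarrow> 'm) \<Rightarrow> ('k \<Rightarrow>\<^sub>0 'r) \<Rightarrow> 'm"
  where "free_lift s f p = (\<Sum>x\<in>Poly_Mapping.keys p. s (Poly_Mapping.lookup p x) (f x))"

lemma free_lift_superset:
  assumes "module s" "finite K" "Poly_Mapping.keys p \<subseteq> K"
  shows "free_lift s f p = (\<Sum>x\<in>K. s (Poly_Mapping.lookup p x) (f x))"
proof -
  interpret module s by fact
  show ?thesis unfolding free_lift_def
    using assms by (intro sum.mono_neutral_left) (auto simp: in_keys_iff)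
qed

lemma free_lift_hom:
  assumes "module s" shows "module_hom pscale s (free_lift s f)"
proof -
  interpret module s by fact
  have "free_lift s f (p + q) = free_lift s f p + free_lift s f q" for p q
  proof -
    let ?K = "Poly_Mapping.keys p \<union> Poly_Mapping.keys q"
    have "free_lift s f (p + q) = (\<Sum>x\<in>?K. s (Poly_Mapping.lookup (p + q) x) (f x))"
      by (rule free_lift_superset) (use assms Poly_Mapping.keys_add[of p q] in auto)
    also have "\<dots> = (\<Sum>x\<in>?K. s (Poly_Mapping.lookup p x) (f x)) + (\<Sum>x\<in>?K. s (Poly_Mapping.lookup q x) (f x))"
      by (simp add: lookup_add scale_left_distrib sum.distrib)
    also have "(\<Sum>x\<in>?K. s (Poly_Mapping.lookup p x) (f x)) = free_lift s f p"
      by (rule free_lift_superset[symmetric]) (use assms in auto)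
    also have "(\<Sum>x\<in>?K. s (Poly_Mapping.lookup q x) (f x)) = free_lift s f q"
      by (rule free_lift_superset[symmetric]) (use assms in auto)
    finally show ?thesis .
  qed
  moreover have "free_lift s f (pscale r p) = s r (free_lift s f p)" for r p
  proof -
    have "Poly_Mapping.keys (pscale r p) \<subseteq> Poly_Mapping.keys p" by (auto simp: in_keys_iff)
    then have "free_lift s f (pscale r p) = (\<Sum>x\<in>Poly_Mapping.keys p. s (Poly_Mapping.lookup (pscale r p) x) (f x))"
      by (intro free_lift_superset) (use assms in auto)
    then show ?thesis by (simp add: free_lift_def scale_sum_right)
  qed
  ultimately show ?thesis
    by (simp add: module_hom_iff assms pm.module_axioms)
qed

lemma free_lift_single [simp]:
  assumes "module s" shows "free_lift s f (Poly_Mapping.single x 1) = f x"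
proof -
  interpret module s by fact
  show ?thesis by (simp add: free_lift_def)
qed


section \<open>The tensor square of a polynomial algebra\<close>

text \<open>The usual construction: the free module on all pairs, modulo the submodule spanned by
  the bilinearity relations.\<close>

definition tensor_relators :: "(('n, 'r) mpoly \<times> ('n, 'r) mpoly \<Rightarrow>\<^sub>0 'r::comm_ring_1) set" where
  "tensor_relators =
     {Poly_Mapping.single (a + a', b) 1 - Poly_Mapping.single (a, b) 1 - Poly_Mapping.single (a', b) 1 | a a' b. True} \<union>
     {Poly_Mapping.single (a, b + b') 1 - Poly_Mapping.single (a, b) 1 - Poly_Mapping.single (a, b') 1 | a b b'. True} \<union>
     {Poly_Mapping.single (pscale r a, b) 1 - pscale r (Poly_Mapping.single (a, b) 1) | r a b. True} \<union>
     {Poly_Mapping.single (a, pscale r b) 1 - pscale r (Poly_Mapping.single (a, b) 1) | r a b. True}"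

definition tensor_eq ::
    "(('n, 'r) mpoly \<times> ('n, 'r) mpoly \<Rightarrow>\<^sub>0 'r::comm_ring_1) \<Rightarrow>
     (('n, 'r) mpoly \<times> ('n, 'r) mpoly \<Rightarrow>\<^sub>0 'r) \<Rightarrow> bool"
  where "tensor_eq p q \<longleftrightarrow> p - q \<in> pm.span tensor_relators"

lemma equivp_tensor_eq: "equivp tensor_eq"
proof (rule equivpI)
  show "reflp tensor_eq" by (simp add: reflp_def tensor_eq_def pm.span_zero)
  show "symp tensor_eq"
    unfolding symp_def tensor_eq_def using pm.span_neg by fastforce
  show "transp tensor_eq"
    unfolding transp_def tensor_eq_def by (metis (no_types) pm.span_add diff_add_cancel add_diff_eq)
qed

quotient_type (overloaded) ('n, 'r) tensor2 =
  "('n, 'r::comm_ring_1) mpoly \<times> ('n, 'r) mpoly \<Rightarrow>\<^sub>0 'r" / tensor_eq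
  by (rule equivp_tensor_eq)

instantiation tensor2 :: (type, comm_ring_1) ab_group_add
begin

lift_definition zero_tensor2 :: "('a, 'b) tensor2" is 0 .

lift_definition plus_tensor2 :: "('a, 'b) tensor2 \<Rightarrow> ('a, 'b) tensor2 \<Rightarrow> ('a, 'b) tensor2" is "(+)"
  unfolding tensor_eq_def by (drule (1) pm.span_add) (simp add: algebra_simps)

lift_definition minus_tensor2 :: "('a, 'b) tensor2 \<Rightarrow> ('a, 'b) tensor2 \<Rightarrow> ('a, 'b) tensor2" is "(-)"
  unfolding tensor_eq_def by (drule (1) pm.span_diff) (simp add: algebra_simps)

lift_definition uminus_tensor2 :: "('a, 'b) tensor2 \<Rightarrow> ('a, 'b) tensor2" is uminus
  unfolding tensor_eq_def by (drule pm.span_neg) (simp add: algebra_simps)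

instance
  by standard (transfer, simp add: tensor_eq_def pm.span_zero algebra_simps)+

end

lift_definition tscale :: "'r::comm_ring_1 \<Rightarrow> ('n, 'r) tensor2 \<Rightarrow> ('n, 'r) tensor2" is pscale
  unfolding tensor_eq_def by (drule pm.span_scale) (simp add: pm.scale_right_diff_distrib)

interpretation ts: module tscale
  by unfold_locales (transfer, simp add: tensor_eq_def pm.span_zero algebra_simps)+

definition tensor :: "('n, 'r::comm_ring_1) mpoly \<Rightarrow> ('n, 'r) mpoly \<Rightarrow> ('n, 'r) tensor2"
    (infixl "\<otimes>" 72)
  where "a \<otimes> b = abs_tensor2 (Poly_Mapping.single (a, b) 1)"

lemma tensor_add_left: "(a + a') \<otimes> b = a \<otimes> b + a' \<otimes> b"
proof -
  have "Poly_Mapping.single (a + a', b) 1 - Poly_Mapping.single (a, b) 1 - Poly_Mapping.single (a', b) 1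
      \<in> tensor_relators"
    unfolding tensor_relators_def by blast
  from pm.span_base[OF this] show ?thesis
    by (simp add: tensor_def plus_tensor2.abs_eq tensor2.abs_eq_iff tensor_eq_def algebra_simps)
qed

lemma tensor_add_right: "a \<otimes> (b + b') = a \<otimes> b + a \<otimes> b'"
proof -
  have "Poly_Mapping.single (a, b + b') 1 - Poly_Mapping.single (a, b) 1 - Poly_Mapping.single (a, b') 1
      \<in> tensor_relators"
    unfolding tensor_relators_def by blast
  from pm.span_base[OF this] show ?thesis
    by (simp add: tensor_def plus_tensor2.abs_eq tensor2.abs_eq_iff tensor_eq_def algebra_simps)
qed

lemma tensor_scale_left: "pscale r a \<otimes> b = tscale r (a \<otimes> b)"
proof -
  have "Poly_Mapping.single (pscale r a, b) 1 - pscale r (Poly_Mapping.single (a, b) 1)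
      \<in> tensor_relators"
    unfolding tensor_relators_def by blast
  from pm.span_base[OF this] show ?thesis
    by (simp add: tensor_def tscale.abs_eq tensor2.abs_eq_iff tensor_eq_def)
qed

lemma tensor_scale_right: "a \<otimes> pscale r b = tscale r (a \<otimes> b)"
proof -
  have "Poly_Mapping.single (a, pscale r b) 1 - pscale r (Poly_Mapping.single (a, b) 1)
      \<in> tensor_relators"
    unfolding tensor_relators_def by blast
  from pm.span_base[OF this] show ?thesis
    by (simp add: tensor_def tscale.abs_eq tensor2.abs_eq_iff tensor_eq_def)
qed

lemma tensor2_induct [case_names tensor add]:
  assumes "\<And>a b. P (a \<otimes> b)" "\<And>x y. P x \<Longrightarrow> P y \<Longrightarrow> P (x + y)"
  shows "P t"
proof -
  have P0: "P 0"
    using assms(1)[of 0 0] tensor_scale_left[of 0 0 0] by (metis pm.scale_zero_left ts.scale_zero_left)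
  have gen: "P (abs_tensor2 p)" for p
  proof (induction p rule: Poly_Mapping.update_induct)
    case const
    show ?case using P0 by (simp add: zero_tensor2.abs_eq)
  next
    case (update f k v)
    obtain a b where k: "k = (a, b)" by (cases k)
    have "pscale v (Poly_Mapping.single k 1) = Poly_Mapping.single k v"
      by (intro poly_mapping_eqI) (simp add: lookup_single when_def)
    then have "abs_tensor2 (Poly_Mapping.single k v) = pscale v a \<otimes> b"
      unfolding k tensor_scale_left by (simp add: tensor_def tscale.abs_eq)
    moreover have "Poly_Mapping.update k v f = f + Poly_Mapping.single k v"
      using update.hyps
      by (intro poly_mapping_eqI)
         (auto simp: lookup_add lookup_single lookup_update when_def in_keys_iff)
    ultimately show ?case using assms update.IH by (simp flip: plus_tensor2.abs_eq)
  qed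
  show ?thesis using gen[of "rep_tensor2 t"]
    by (simp add: Quotient3_abs_rep[OF Quotient3_tensor2])
qed

text \<open>Universal property: an \<open>R\<close>-bilinear map induces a unique \<open>R\<close>-linear map on the tensor
  square. \<open>tensor_lift s f\<close> is meaningful only when \<open>f\<close> is bilinear; it is then independent of
  the chosen representatives.\<close>

definition bilinear_map ::
    "('r::comm_ring_1 \<Rightarrow> 'm \<Rightarrow> 'm) \<Rightarrow> (('n, 'r) mpoly \<Rightarrow> ('n, 'r) mpoly \<Rightarrow> 'm::ab_group_add) \<Rightarrow> bool"
  where "bilinear_map s f \<longleftrightarrow>
    (\<forall>b. module_hom pscale s (\<lambda>a. f a b)) \<and> (\<forall>a. module_hom pscale s (f a))"

definition tensor_lift ::
    "('r::comm_ring_1 \<Rightarrow> 'm \<Rightarrow> 'm) \<Rightarrow> (('n, 'r) mpoly \<Rightarrow> ('n, 'r) mpoly \<Rightarrow> 'm::ab_group_add) \<Rightarrow>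
     ('n, 'r) tensor2 \<Rightarrow> 'm"
  where "tensor_lift s f t = free_lift s (\<lambda>(a, b). f a b) (rep_tensor2 t)"

lemma bilinear_mapD:
  assumes "bilinear_map s f"
  shows "module s" "f (a + a') b = f a b + f a' b" "f (pscale r a) b = s r (f a b)"
    "f a (b + b') = f a b + f a b'" "f a (pscale r b) = s r (f a b)"
  using assms by (auto simp: bilinear_map_def module_hom_iff)

lemma tensor_lift_abs:
  assumes "bilinear_map s f"
  shows "tensor_lift s f (abs_tensor2 p) = free_lift s (\<lambda>(a, b). f a b) p"
proof -
  note s = bilinear_mapD(1)[OF assms]
  let ?g = "free_lift s (\<lambda>(a, b). f a b)"
  interpret g: module_hom pscale s ?g by (rule free_lift_hom[OF s])
  have "?g x = 0" if "x \<in> tensor_relators" for x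
    using that unfolding tensor_relators_def
    by (elim UnE) (auto simp: g.diff g.scale s bilinear_mapD[OF assms])
  then have 0: "?g x = 0" if "x \<in> pm.span tensor_relators" for x
    using that by (rule g.eq_0_on_span)
  have "tensor_eq (rep_tensor2 (abs_tensor2 p)) p"
    by (simp add: Quotient3_rep_abs[OF Quotient3_tensor2] equivp_reflp[OF equivp_tensor_eq])
  then show ?thesis
    unfolding tensor_lift_def tensor_eq_def by (auto dest!: 0 simp: g.diff)
qed

lemma tensor_lift_tensor [simp]:
  "bilinear_map s f \<Longrightarrow> tensor_lift s f (a \<otimes> b) = f a b"
  by (simp add: tensor_def tensor_lift_abs bilinear_mapD(1))

lemma tensor_lift_hom:
  assumes "bilinear_map s f"
  shows "module_hom tscale s (tensor_lift s f)"
proof -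
  note s = bilinear_mapD(1)[OF assms]
  let ?g = "free_lift s (\<lambda>(a, b). f a b)"
  interpret g: module_hom pscale s ?g by (rule free_lift_hom[OF s])
  have ex: "\<exists>p. t = abs_tensor2 p" for t
    using Quotient3_abs_rep[OF Quotient3_tensor2, of t] by metis
  have "tensor_lift s f (t + u) = tensor_lift s f t + tensor_lift s f u" for t u
    using ex[of t] ex[of u]
    by (auto simp: plus_tensor2.abs_eq tensor_lift_abs[OF assms] g.add)
  moreover have "tensor_lift s f (tscale r t) = s r (tensor_lift s f t)" for r t
    using ex[of t] by (auto simp: tscale.abs_eq tensor_lift_abs[OF assms] g.scale)
  ultimately show ?thesis
    by (simp add: module_hom_iff s ts.module_axioms)
qed

lemma tensor2_hom_eqI:
  assumes "module_hom tscale s f" "module_hom tscale s g" "\<And>a b. f (a \<otimes> b) = g (a \<otimes> b)"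
  shows "f = g"
proof
  fix t show "f t = g t"
    by (induction t rule: tensor2_induct) (use assms in \<open>auto simp: module_hom_iff\<close>)
qed

lemma bilinear_tensor_mult:
  "bilinear_map tscale (\<lambda>a' b'. (a * a') \<otimes> (b * b'))"
  by (simp add: bilinear_map_def module_hom_iff pm.module_axioms ts.module_axioms distrib_left
      pscale_mult_right tensor_add_left tensor_add_right tensor_scale_left tensor_scale_right)

lemma bilinear_tensor_mult_lift:
  fixes y :: "('n, 'r::comm_ring_1) tensor2"
  shows "bilinear_map tscale (\<lambda>a b. tensor_lift tscale (\<lambda>a' b'. (a * a') \<otimes> (b * b')) y)"
proof -
  define L where "L = (\<lambda>a b. tensor_lift tscale (\<lambda>a' b'. (a * a') \<otimes> (b * b' :: ('n, 'r) mpoly)))"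
  have pure: "L a b (c \<otimes> d) = (a * c) \<otimes> (b * d)" for a b c d
    unfolding L_def by (rule tensor_lift_tensor[OF bilinear_tensor_mult])
  have add: "L a b (x + y) = L a b x + L a b y" for a b x y
    using tensor_lift_hom[OF bilinear_tensor_mult, of a b] by (simp add: L_def module_hom_iff)
  have "L (a + a') b y = L a b y + L a' b y" for a a' b
    by (induction y rule: tensor2_induct)
       (simp_all add: pure add distrib_right tensor_add_left)
  moreover have "L a (b + b') y = L a b y + L a b' y" for a b b'
    by (induction y rule: tensor2_induct)
       (simp_all add: pure add distrib_right tensor_add_right)
  moreover have "L (pscale r a) b y = tscale r (L a b y)" for r a b
    by (induction y rule: tensor2_induct)
       (simp_all add: pure add pscale_mult_left tensor_scale_left ts.scale_right_distrib)
  moreover have "L a (pscale r b) y = tscale r (L a b y)" for r a b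
    by (induction y rule: tensor2_induct)
       (simp_all add: pure add pscale_mult_left tensor_scale_right ts.scale_right_distrib)
  ultimately have "bilinear_map tscale (\<lambda>a b. L a b y)"
    by (simp add: bilinear_map_def module_hom_iff pm.module_axioms ts.module_axioms)
  then show ?thesis by (simp add: L_def)
qed

definition tensor_mu :: "('n, 'r::comm_ring_1) tensor2 \<Rightarrow> ('n, 'r) mpoly"
  where "tensor_mu = tensor_lift pscale (*)"

definition tensor_swap :: "('n, 'r::comm_ring_1) tensor2 \<Rightarrow> ('n, 'r) tensor2"
  where "tensor_swap = tensor_lift tscale (\<lambda>a b. b \<otimes> a)"

lemma bilinear_times: "bilinear_map pscale (*)"
  by (simp add: bilinear_map_def module_hom_iff pm.module_axioms distrib_left distrib_right
      pscale_mult_left pscale_mult_right)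

lemma bilinear_swap: "bilinear_map tscale (\<lambda>a b. b \<otimes> a)"
  by (simp add: bilinear_map_def module_hom_iff pm.module_axioms ts.module_axioms
      tensor_add_left tensor_add_right tensor_scale_left tensor_scale_right)

lemma tensor_mu_tensor [simp]: "tensor_mu (a \<otimes> b) = a * b"
  by (simp add: tensor_mu_def bilinear_times)

lemma tensor_mu_hom: "module_hom tscale pscale tensor_mu"
  unfolding tensor_mu_def by (rule tensor_lift_hom[OF bilinear_times])

lemmas tensor_mu_linear [simp] = module_hom.add[OF tensor_mu_hom] module_hom.scale[OF tensor_mu_hom]
  module_hom.zero[OF tensor_mu_hom]

lemma tensor_swap_tensor [simp]: "tensor_swap (a \<otimes> b) = b \<otimes> a"
  by (simp add: tensor_swap_def bilinear_swap)

lemma tensor_swap_hom: "module_hom tscale tscale tensor_swap"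
  unfolding tensor_swap_def by (rule tensor_lift_hom[OF bilinear_swap])

lemmas tensor_swap_linear [simp] = module_hom.add[OF tensor_swap_hom] module_hom.scale[OF tensor_swap_hom]
  module_hom.zero[OF tensor_swap_hom]

instantiation tensor2 :: (type, comm_ring_1) comm_ring_1
begin

definition times_tensor2 :: "('a, 'b) tensor2 \<Rightarrow> ('a, 'b) tensor2 \<Rightarrow> ('a, 'b) tensor2"
  where "x * y =
    tensor_lift tscale (\<lambda>a b. tensor_lift tscale (\<lambda>a' b'. (a * a') \<otimes> (b * b')) y) x"

definition one_tensor2 :: "('a, 'b) tensor2"
  where "1 = 1 \<otimes> 1"

lemma tensor_mult_tensor: "(a \<otimes> b) * (a' \<otimes> b') = (a * a') \<otimes> (b * b' :: ('a, 'b) mpoly)"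
  unfolding times_tensor2_def
  by (rule trans[OF tensor_lift_tensor[OF bilinear_tensor_mult_lift]
        tensor_lift_tensor[OF bilinear_tensor_mult]])

instance
proof
  fix x y z :: "('a, 'b) tensor2"
  have add_left: "(x + y) * z = x * z + y * z" for x y z :: "('a, 'b) tensor2"
    using tensor_lift_hom[OF bilinear_tensor_mult_lift, of z]
    by (simp add: times_tensor2_def module_hom_iff)
  have add_right_pure: "(a \<otimes> b) * (y + z) = (a \<otimes> b) * y + (a \<otimes> b) * z"
    for a b and y z :: "('a, 'b) tensor2"
    using tensor_lift_hom[OF bilinear_tensor_mult, of a b]
    by (simp add: times_tensor2_def bilinear_tensor_mult_lift module_hom_iff)
  have comm_pure: "(a \<otimes> b) * y = y * (a \<otimes> b)" for a b and y :: "('a, 'b) tensor2"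
    by (induction y rule: tensor2_induct)
       (simp_all add: tensor_mult_tensor add_left add_right_pure mult.commute)
  have add_right: "x * (y + z) = x * y + x * z" for x y z :: "('a, 'b) tensor2"
    by (induction x rule: tensor2_induct) (simp_all add: add_left add_right_pure)
  show "x * y = y * x"
    by (induction x rule: tensor2_induct) (simp_all add: comm_pure add_left add_right)
  show "(x + y) * z = x * z + y * z" by (rule add_left)
  have assoc1: "(a \<otimes> b) * (c \<otimes> d) * z = (a \<otimes> b) * ((c \<otimes> d) * z)"
    for a b c d and z :: "('a, 'b) tensor2"
    by (induction z rule: tensor2_induct)
       (simp_all add: tensor_mult_tensor add_right mult.assoc)
  have assoc2: "(a \<otimes> b) * y * z = (a \<otimes> b) * (y * z)"
    for a b and y z :: "('a, 'b) tensor2"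
    by (induction y rule: tensor2_induct) (simp_all add: assoc1 add_left add_right)
  show "x * y * z = x * (y * z)"
    by (induction x rule: tensor2_induct) (simp_all add: assoc2 add_left)
  show "1 * x = x"
    by (induction x rule: tensor2_induct)
       (simp_all add: one_tensor2_def tensor_mult_tensor add_right)
  show "(0 :: ('a, 'b) tensor2) \<noteq> 1"
  proof
    assume "(0 :: ('a, 'b) tensor2) = 1"
    then have "tensor_mu (0 :: ('a, 'b) tensor2) = tensor_mu (1 \<otimes> 1)"
      by (simp only: one_tensor2_def)
    then show False by (simp del: one_neq_zero add: one_neq_zero)
  qed
qed

end


section \<open>Multi-derivations\<close>

definition derivation_last :: "(('n, 'r::comm_ring_1) tensor2 \<Rightarrow> ('n, 'r) tensor2) \<Rightarrow> bool"
  where "derivation_last \<phi> \<longleftrightarrow>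
    (\<forall>a b c. \<phi> (c \<otimes> (a * b)) = (a \<otimes> 1) * \<phi> (c \<otimes> b) + \<phi> (c \<otimes> a) * (1 \<otimes> b))"

definition MDer :: "(('n, 'r::comm_ring_1) tensor2 \<Rightarrow> ('n, 'r) tensor2) set"
  where "MDer = {\<phi>. module_hom tscale tscale \<phi> \<and>
    derivation_last \<phi> \<and> derivation_last (tensor_swap \<circ> \<phi> \<circ> tensor_swap)}"

text \<open>\<open>MDer\<close> is an \<open>R\<close>-submodule, and composition with \<open>\<mu>\<close> is an \<open>R\<close>-linear map from it into
  \<open>Hom\<^sub>R(A \<otimes> A, A)\<close>.\<close>

lemma tscale_mult_left: "tscale r x * y = tscale r (x * y)"
  using tensor_lift_hom[OF bilinear_tensor_mult_lift, of y]
  by (simp add: times_tensor2_def module_hom_iff)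

lemma tscale_mult_right: "x * tscale r y = tscale r (x * y)"
  by (metis mult.commute tscale_mult_left)

lemma MDer_zero: "(\<lambda>_. 0) \<in> MDer"
  by (simp add: MDer_def derivation_last_def module_hom_iff ts.module_axioms)

lemma MDer_add: "\<phi> \<in> MDer \<Longrightarrow> \<psi> \<in> MDer \<Longrightarrow> (\<lambda>x. \<phi> x + \<psi> x) \<in> MDer"
  by (simp add: MDer_def derivation_last_def module_hom_iff ts.scale_right_distrib algebra_simps)

lemma MDer_scale: "\<phi> \<in> MDer \<Longrightarrow> (\<lambda>x. tscale r (\<phi> x)) \<in> MDer"
  by (simp add: MDer_def derivation_last_def module_hom_iff ts.scale_right_distrib
      tscale_mult_left tscale_mult_right mult.commute)

lemma tensor_mu_comp_hom: "\<phi> \<in> MDer \<Longrightarrow> module_hom tscale pscale (tensor_mu \<circ> \<phi>)"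
  unfolding MDer_def using tensor_mu_hom by (auto intro: module_hom_compose)

lemma tensor_mu_comp_add:
  "tensor_mu \<circ> (\<lambda>x. \<phi> x + \<psi> x) = (\<lambda>x. (tensor_mu \<circ> \<phi>) x + (tensor_mu \<circ> \<psi>) x)"
  by (simp add: module_hom_iff fun_eq_iff)

lemma tensor_mu_comp_scale:
  "tensor_mu \<circ> (\<lambda>x. tscale r (\<phi> x)) = (\<lambda>x. pscale r ((tensor_mu \<circ> \<phi>) x))"
  by (simp add: module_hom_iff fun_eq_iff)

end

theory Submission
  imports Defs
begin

text \<open>
  Write \<open>\<delta> a = a \<otimes> 1 - 1 \<otimes> a\<close> and let \<open>\<phi>\<close> be a derivation with respect to the last
  variable. Since \<open>a b = b a\<close>, expanding \<open>\<phi> (c \<otimes> a b)\<close> in both orders gives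
  \<open>\<delta> a \<cdot> \<phi> (c \<otimes> b) = \<delta> b \<cdot> \<phi> (c \<otimes> a)\<close>. In the tensor square, which is a polynomial algebra
  in twice as many variables, the elements \<open>\<delta> t\<^sub>1, \<delta> t\<^sub>2, \<dots>\<close> form a regular sequence, so this
  forces \<open>\<delta> t\<^sub>i\<close> to divide \<open>\<phi> (c \<otimes> t\<^sub>i)\<close>, and \<open>\<mu>\<close> kills \<open>\<delta> t\<^sub>i\<close>.

  Only the first-order shadow of that regularity matters. Every \<open>R\<close>-derivation \<open>d\<close> of \<open>A\<close> induces the
  linear map \<open>a \<otimes> b \<mapsto> a \<cdot> d b\<close>, which is a derivation of \<open>A \<otimes> A\<close> along \<open>\<mu>\<close> and takes \<open>\<delta> a \<cdot> x\<close>
  to \<open>- d a \<cdot> \<mu> x\<close>. Applied to the identity above it yields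
  \<open>d a \<cdot> \<mu> (\<phi> (c \<otimes> b)) = d b \<cdot> \<mu> (\<phi> (c \<otimes> a))\<close> for all \<open>a\<close>, \<open>b\<close>, \<open>c\<close> and \<open>d\<close>
  (\<open>derivation_last_exchange\<close>). With \<open>d = \<partial>/\<partial>t\<^sub>i\<close>, \<open>a = t\<^sub>i\<close> and \<open>b = t\<^sub>j\<close> for \<open>j \<noteq> i\<close> this reads
  \<open>\<mu> (\<phi> (c \<otimes> t\<^sub>j)) = 0\<close>; with \<open>d = \<partial>/\<partial>t\<^sub>j\<close>, \<open>a = t\<^sub>j\<close> and \<open>b\<close> arbitrary it then reads
  \<open>\<mu> (\<phi> (c \<otimes> b)) = 0\<close>. A second variable besides \<open>t\<^sub>j\<close> is what starts this argument.
\<close>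

definition is_derivation :: "(('n, 'r::comm_ring_1) mpoly \<Rightarrow> ('n, 'r) mpoly) \<Rightarrow> bool"
  where "is_derivation d \<longleftrightarrow>
    module_hom pscale pscale d \<and> (\<forall>a b. d (a * b) = a * d b + d a * b)"

lemma derivation_last_commutator:
  assumes "derivation_last \<phi>"
  shows "(a \<otimes> 1 - 1 \<otimes> a) * \<phi> (c \<otimes> b) = (b \<otimes> 1 - 1 \<otimes> b) * \<phi> (c \<otimes> a)"
proof -
  have "(a \<otimes> 1) * \<phi> (c \<otimes> b) + \<phi> (c \<otimes> a) * (1 \<otimes> b) = \<phi> (c \<otimes> (a * b))"
    using assms by (simp add: derivation_last_def)
  also have "\<dots> = \<phi> (c \<otimes> (b * a))"
    by (simp add: mult.commute)
  also have "\<dots> = (b \<otimes> 1) * \<phi> (c \<otimes> a) + \<phi> (c \<otimes> b) * (1 \<otimes> a)"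
    using assms by (simp add: derivation_last_def)
  finally show ?thesis by (simp add: algebra_simps)
qed

text \<open>The map \<open>D\<close> in the proof is the \<open>\<epsilon>\<close>-part of the algebra homomorphism
  \<open>a \<otimes> b \<mapsto> a (b + \<epsilon> d b)\<close> into the dual numbers over \<open>A\<close>, which sends \<open>\<delta> a\<close> to \<open>- \<epsilon> d a\<close>.\<close>

lemma derivation_last_exchange:
  fixes \<phi> :: "('n, 'r::comm_ring_1) tensor2 \<Rightarrow> ('n, 'r) tensor2"
  assumes "derivation_last \<phi>" and d: "is_derivation d"
  shows "d a * tensor_mu (\<phi> (c \<otimes> b)) = d b * tensor_mu (\<phi> (c \<otimes> a))"
proof -
  define D where "D = tensor_lift pscale (\<lambda>a b. a * d b)"
  have d_add: "d (x + y) = d x + d y" and d_scale: "d (pscale r x) = pscale r (d x)"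
    and d_mult: "d (x * y) = x * d y + d x * y" for r x y
    using d unfolding is_derivation_def module_hom_iff by blast+
  have bil: "bilinear_map pscale (\<lambda>a b. a * d b)"
    by (simp add: bilinear_map_def module_hom_iff pm.module_axioms d_add d_scale
        distrib_left distrib_right pscale_mult_left pscale_mult_right)
  have pure: "D (x \<otimes> y) = x * d y" for x y
    unfolding D_def by (rule tensor_lift_tensor[OF bil])
  interpret D: module_hom tscale pscale D
    unfolding D_def by (rule tensor_lift_hom[OF bil])
  have D_delta: "D ((x \<otimes> 1 - 1 \<otimes> x) * t) = - (d x * tensor_mu t)" for x t
  proof (induction t rule: tensor2_induct)
    case (tensor a b)
    show ?case
      by (simp add: left_diff_distrib tensor_mult_tensor pure D.diff d_mult algebra_simps)
  next
    case (add t u)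
    then show ?case by (simp add: distrib_left D.add)
  qed
  show ?thesis
    using arg_cong[OF derivation_last_commutator[OF assms(1), of a c b], of D]
    by (simp add: D_delta)
qed

definition var :: "'n \<Rightarrow> ('n, 'r::comm_ring_1) mpoly"
  where "var i = Poly_Mapping.single (Poly_Mapping.single i 1) 1"

text \<open>On a monomial free of \<open>t\<^sub>i\<close> the truncated difference of exponents is meaningless, but there the
  coefficient vanishes.\<close>

definition partial_deriv :: "'n \<Rightarrow> ('n, 'r::comm_ring_1) mpoly \<Rightarrow> ('n, 'r) mpoly"
  where "partial_deriv i = free_lift pscale (\<lambda>m.
    Poly_Mapping.single (m - Poly_Mapping.single i 1) (of_nat (Poly_Mapping.lookup m i)))"

lemma partial_deriv_hom: "module_hom pscale pscale (partial_deriv i)"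
  unfolding partial_deriv_def by (rule free_lift_hom[OF pm.module_axioms])

lemma partial_deriv_monomial:
  "partial_deriv i (Poly_Mapping.single m 1) =
    Poly_Mapping.single (m - Poly_Mapping.single i 1) (of_nat (Poly_Mapping.lookup m i))"
  unfolding partial_deriv_def by (rule free_lift_single[OF pm.module_axioms])

lemma partial_deriv_var:
  "partial_deriv i (var j :: ('n, 'r::comm_ring_1) mpoly) = (if i = j then 1 else 0)"
  by (simp add: var_def partial_deriv_monomial lookup_single when_def del: One_nat_def)

lemma mpoly_linear_induct [case_names monomial add scale]:
  fixes p :: "('n, 'r::comm_ring_1) mpoly"
  assumes monomial: "\<And>m. P (Poly_Mapping.single m 1)"
    and add: "\<And>p q. P p \<Longrightarrow> P q \<Longrightarrow> P (p + q)"
    and scale: "\<And>r p. P p \<Longrightarrow> P (pscale r p)"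
  shows "P p"
proof (induction p rule: Poly_Mapping.update_induct)
  case const
  show ?case using scale[OF monomial, of 0] by simp
next
  case (update p m r)
  have "Poly_Mapping.update m r p = p + pscale r (Poly_Mapping.single m 1)"
    using update.hyps
    by (intro poly_mapping_eqI)
       (auto simp: lookup_add lookup_single lookup_update when_def in_keys_iff)
  then show ?case using add[OF update.IH scale[OF monomial]] by simp
qed

lemma partial_deriv_is_derivation:
  "is_derivation (partial_deriv i :: ('n, 'r::comm_ring_1) mpoly \<Rightarrow> ('n, 'r) mpoly)"
proof -
  let ?d = "partial_deriv i :: ('n, 'r) mpoly \<Rightarrow> ('n, 'r) mpoly"
  let ?e = "Poly_Mapping.single i 1 :: 'n \<Rightarrow>\<^sub>0 nat"
  interpret d: module_hom pscale pscale ?d by (rule partial_deriv_hom)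
  (* m + (n - e) = m + n - e unless n lacks the i-th variable, and then both sides are 0 *)
  have shift: "Poly_Mapping.single (m + (n - ?e)) (of_nat (Poly_Mapping.lookup n i))
      = (Poly_Mapping.single (m + n - ?e) (of_nat (Poly_Mapping.lookup n i)) :: ('n, 'r) mpoly)" for m n
  proof (cases "Poly_Mapping.lookup n i = 0")
    case False
    then have "m + (n - ?e) = m + n - ?e"
      by (intro poly_mapping_eqI) (auto simp: lookup_add lookup_minus lookup_single when_def)
    then show ?thesis by simp
  qed simp
  have monomials: "?d (Poly_Mapping.single m 1 * Poly_Mapping.single n 1) =
      Poly_Mapping.single m 1 * ?d (Poly_Mapping.single n 1)
      + ?d (Poly_Mapping.single m 1) * Poly_Mapping.single n 1" for m n
    using shift[of m n] shift[of n m]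
    by (simp add: mult_single partial_deriv_monomial lookup_add single_add add.commute
        del: One_nat_def)
  have left: "?d (Poly_Mapping.single m 1 * q) =
      Poly_Mapping.single m 1 * ?d q + ?d (Poly_Mapping.single m 1) * q" for m q
    by (induction q rule: mpoly_linear_induct)
       (simp_all add: monomials d.add d.scale distrib_left pscale_mult_right
          pm.scale_right_distrib)
  have "?d (p * q) = p * ?d q + ?d p * q" for p q
    by (induction p rule: mpoly_linear_induct)
       (simp_all add: left d.add d.scale distrib_right pscale_mult_left pm.scale_right_distrib)
  then show ?thesis by (simp add: is_derivation_def partial_deriv_hom)
qed

lemma tensor_mu_derivation_last_eq_0:
  fixes \<phi> :: "('n, 'r::comm_ring_1) tensor2 \<Rightarrow> ('n, 'r) tensor2"
    and i j :: 'n
  assumes \<phi>: "derivation_last \<phi>" and "i \<noteq> j"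
  shows "tensor_mu (\<phi> (c \<otimes> b)) = 0"
proof -
  have "tensor_mu (\<phi> (c \<otimes> var j)) = 0"
    using derivation_last_exchange[OF \<phi> partial_deriv_is_derivation, of i "var i" c "var j"]
      \<open>i \<noteq> j\<close> by (simp add: partial_deriv_var)
  then show ?thesis
    using derivation_last_exchange[OF \<phi> partial_deriv_is_derivation, of j "var j" c b]
    by (simp add: partial_deriv_var)
qed

theorem corollary4p7:
  assumes "CARD('n::finite) \<ge> 2"
  shows "\<forall>\<phi> \<in> (MDer :: (('n, 'r::comm_ring_1) tensor2 \<Rightarrow> ('n, 'r) tensor2) set).
           tensor_mu \<circ> \<phi> = (\<lambda>_. 0)"
proof
  fix \<phi> :: "('n, 'r) tensor2 \<Rightarrow> ('n, 'r) tensor2"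
  assume \<phi>: "\<phi> \<in> MDer"
  obtain i j :: 'n where "i \<noteq> j"
    using assms card_le_Suc0_iff_eq[of "UNIV :: 'n set"] by auto
  then have "tensor_mu (\<phi> (c \<otimes> b)) = 0" for c b
    using \<phi> by (intro tensor_mu_derivation_last_eq_0) (auto simp: MDer_def)
  moreover have "module_hom tscale pscale (\<lambda>_ :: ('n, 'r) tensor2. 0 :: ('n, 'r) mpoly)"
    by (simp add: module_hom_iff ts.module_axioms pm.module_axioms)
  ultimately show "tensor_mu \<circ> \<phi> = (\<lambda>_. 0)"
    by (intro tensor2_hom_eqI[OF tensor_mu_comp_hom[OF \<phi>]]) auto
qed

end
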